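(* Let $r$ be a positive integer, let $A$ be a finite set of $k \geq 6$ positive integers, and let $H$ be a set of $t \geq 2$ positive integers with $1 \leq r \leq \max(H) \leq (k-1)r-1$. If \[ |H^{(r)}A| = \mathcal{L}_k(H,r), \] then $H$ is an arithmetic progression with common difference $d \leq r$ and $A$ is an arithmetic progression with common difference $d\cdot \min(A)$.
   Context: For a finite set $A=\{a_1,\ldots,a_k\}$ of integers and positive integers $h, r$, $h^{(r)}A=\{\sum_{i=1}^k \lambda_i a_i : 0\le \lambda_i\le r,\ \sum_{i=1}^k\lambda_i=h\}$, and for a finite set $H$ of positive integers, $H^{(r)}A=\bigcup_{h\in H} h^{(r)}A$. For a set $H=\{h_1<\cdots<h_t\}$ of positive integers, a positive integer $r$ and an integer $k$, put $h_0=0$ and, for $0\le i\le t$, write $h_i=m_i r+\epsilon_i$ with $m_i=\lfloor h_i/r\rfloor$, $0\le \epsilon_i\le r-1$. Define \[\mathcal{L}_k(H,r)=\sum_{i=1}^{t}\Big( r(m_i-m_{i-1})(k-m_i)+(\epsilon_i-\epsilon_{i-1})(k-m_i-1)-\max\{\epsilon_i,\epsilon_{i-1}\}(m_i-m_{i-1})+1\Big).\] A set is an arithmetic progression with common difference $d$ if it has the form $\{a, a+d, \ldots, a+(n-1)d\}$. *)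

theory Defs
  imports Main
begin

text \<open>\<open>gen_sumset r h A\<close> is $h^{(r)}A$, and \<open>gen_sumset_family r H A\<close> is $H^{(r)}A$.\<close>

definition gen_sumset :: "nat \<Rightarrow> nat \<Rightarrow> int set \<Rightarrow> int set" where
  "gen_sumset r h A =
     {(\<Sum>a\<in>A. int (l a) * a) | l :: int \<Rightarrow> nat.
        (\<forall>a\<in>A. l a \<le> r) \<and> (\<Sum>a\<in>A. l a) = h}"

definition gen_sumset_family :: "nat \<Rightarrow> nat set \<Rightarrow> int set \<Rightarrow> int set" where
  "gen_sumset_family r H A = (\<Union>h\<in>H. gen_sumset r h A)"

text \<open>\<open>nth_elem H i\<close> is the \<open>i\<close>-th smallest element of \<open>H\<close> for \<open>1 \<le> i \<le> card H\<close>, preceded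
  by the value \<open>0\<close> at index \<open>0\<close>.\<close>

definition nth_elem :: "nat set \<Rightarrow> nat \<Rightarrow> nat" where
  "nth_elem H i = (0 # sorted_list_of_set H) ! i"

text \<open>The value lies in the integers: \<open>m i - m (i - 1)\<close> is nonnegative, but
  \<open>\<epsilon> i - \<epsilon> (i - 1)\<close> and \<open>k - m i - 1\<close> can be negative.\<close>

definition L_bound :: "int \<Rightarrow> nat set \<Rightarrow> nat \<Rightarrow> int" where
  "L_bound k H r =
     (let m = (\<lambda>i. int (nth_elem H i div r));
          \<epsilon> = (\<lambda>i. int (nth_elem H i mod r))
      in \<Sum>i = 1..card H.
           int r * (m i - m (i - 1)) * (k - m i)
           + (\<epsilon> i - \<epsilon> (i - 1)) * (k - m i - 1)
           - max (\<epsilon> i) (\<epsilon> (i - 1)) * (m i - m (i - 1))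
           + 1)"

definition is_arith_prog :: "'a::semiring_1 \<Rightarrow> 'a set \<Rightarrow> bool" where
  "is_arith_prog d S \<longleftrightarrow> (\<exists>a n. n \<ge> 1 \<and> S = {a + of_nat i * d | i. i < n})"

end

theory Submission
  imports Defs "HOL-Library.FuncSet"
begin

text \<open>
  Grade a coefficient vector \<open>l\<close> of total \<open>h\<^sub>i\<close> by \<open>\<Sum>n. n * l n\<close>, shifted by a constant
  depending on \<open>i\<close>. Moving one unit to an adjacent position changes the grade by one and
  the represented sum strictly; so does passing to the next level by adding the cheapest vector of
  total \<open>h\<^sub>i\<^sub>+\<^sub>1 - h\<^sub>i\<close> to the top vector of level \<open>h\<^sub>i\<close>, since the elements of \<open>A\<close> are positive.
  Hence every vector has a neighbour in both directions until the extreme grades, and the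
  number of grades is at least \<open>L\<close>. If there are only \<open>L\<close> sums, then the sum is a function
  of the grade. Comparing vectors of equal grade inside the last level shows that distant consecutive
  differences of \<open>A\<close> agree, so \<open>A\<close> is a progression with some difference \<open>\<delta>\<close>; comparing the
  top of level \<open>h\<^sub>i\<close> with a vector of level \<open>h\<^sub>i\<^sub>+\<^sub>1\<close> of the same grade shows that the cheapest vector
  of total \<open>h\<^sub>i\<^sub>+\<^sub>1 - h\<^sub>i\<close> has value \<open>\<delta>\<close>. This value would exceed \<open>\<delta>\<close> if the gap were larger
  than \<open>r\<close>, and otherwise it is \<open>(h\<^sub>i\<^sub>+\<^sub>1 - h\<^sub>i) * min A\<close>.
\<close>

section \<open>Graded families of values\<close>

lemma grade_le_card_below:
  fixes v :: "'a \<Rightarrow> 'b" and \<rho> :: "'a \<Rightarrow> int"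
  assumes fin: "finite (v ` C)" and trans: "transp R" and irrefl: "irreflp R"
    and descent: "\<And>x. \<lbrakk>x \<in> C; 0 < \<rho> x\<rbrakk> \<Longrightarrow> \<exists>y\<in>C. \<rho> x \<le> \<rho> y + 1 \<and> R (v y) (v x)"
    and "x \<in> C"
  shows "\<rho> x \<le> int (card {s \<in> v ` C. R s (v x)})"
  using \<open>x \<in> C\<close>
proof (induction "card {s \<in> v ` C. R s (v x)}" arbitrary: x rule: less_induct)
  case less
  show ?case
  proof (cases "0 < \<rho> x")
    case True
    then obtain y where "y \<in> C" and grade: "\<rho> x \<le> \<rho> y + 1" and "R (v y) (v x)"
      using descent less.prems by blast
    then have "{s \<in> v ` C. R s (v y)} \<subset> {s \<in> v ` C. R s (v x)}"
      using transpD[OF trans] irreflpD[OF irrefl] by blast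
    then have "card {s \<in> v ` C. R s (v y)} < card {s \<in> v ` C. R s (v x)}"
      using fin by (intro psubset_card_mono) auto
    then show ?thesis using less.hyps[OF _ \<open>y \<in> C\<close>] grade by linarith
  qed simp
qed

lemma card_less_add_card_greater:
  fixes S :: "'a::linorder set"
  assumes "finite S" "x \<in> S"
  shows "Suc (card {s \<in> S. s < x} + card {s \<in> S. x < s}) = card S"
proof -
  have "card S = Suc (card (S - {x}))" using card_Suc_Diff1[OF assms] ..
  also have "S - {x} = {s \<in> S. s < x} \<union> {s \<in> S. x < s}" by auto
  also have "card \<dots> = card {s \<in> S. s < x} + card {s \<in> S. x < s}"
    using assms(1) by (intro card_Un_disjoint) auto
  finally show ?thesis ..
qed

lemma value_eq_if_grade_eq:
  fixes v :: "'a \<Rightarrow> 'b::linorder" and \<rho> :: "'a \<Rightarrow> int"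
  assumes fin: "finite (v ` C)" and card_le: "int (card (v ` C)) \<le> N"
    and down: "\<And>x. \<lbrakk>x \<in> C; 0 < \<rho> x\<rbrakk> \<Longrightarrow> \<exists>y\<in>C. \<rho> y = \<rho> x - 1 \<and> v y < v x"
    and up: "\<And>x. \<lbrakk>x \<in> C; \<rho> x < N - 1\<rbrakk> \<Longrightarrow> \<exists>y\<in>C. \<rho> y = \<rho> x + 1 \<and> v x < v y"
    and "x \<in> C" "y \<in> C" "\<rho> x = \<rho> y"
  shows "v x = v y"
proof -
  have card_below: "int (card {s \<in> v ` C. s < v z}) = \<rho> z" if "z \<in> C" for z
  proof -
    have "\<rho> z \<le> int (card {s \<in> v ` C. s < v z})"
    proof (rule grade_le_card_below[OF fin])
      show "\<exists>y\<in>C. \<rho> x \<le> \<rho> y + 1 \<and> v y < v x" if "x \<in> C" "0 < \<rho> x" for x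
        using down[OF that] by force
    qed (simp_all add: that)
    moreover have "N - 1 - \<rho> z \<le> int (card {s \<in> v ` C. v z < s})"
    proof (rule grade_le_card_below[OF fin, of "(>)" "\<lambda>z. N - 1 - \<rho> z"])
      show "\<exists>y\<in>C. N - 1 - \<rho> x \<le> N - 1 - \<rho> y + 1 \<and> v x < v y"
        if "x \<in> C" "0 < N - 1 - \<rho> x" for x
        using up[of x] that by force
    qed (simp_all add: that)
    moreover have "Suc (card {s \<in> v ` C. s < v z} + card {s \<in> v ` C. v z < s}) = card (v ` C)"
      using fin that by (intro card_less_add_card_greater) auto
    ultimately show ?thesis using card_le by linarith
  qed
  have not_less: "\<not> v z < v z'" if "z \<in> C" "z' \<in> C" "\<rho> z = \<rho> z'" for z z'
  proof
    assume "v z < v z'"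
    then have "{s \<in> v ` C. s < v z} \<subset> {s \<in> v ` C. s < v z'}" using that(1) by auto
    then have "card {s \<in> v ` C. s < v z} < card {s \<in> v ` C. s < v z'}"
      using fin by (intro psubset_card_mono) auto
    then show False using card_below[OF that(1)] card_below[OF that(2)] that(3) by simp
  qed
  show ?thesis
    using not_less[of x y] not_less[of y x] \<open>x \<in> C\<close> \<open>y \<in> C\<close> \<open>\<rho> x = \<rho> y\<close> by simp
qed

section \<open>Coefficient vectors\<close>

definition coeff_vecs :: "nat \<Rightarrow> nat \<Rightarrow> nat \<Rightarrow> (nat \<Rightarrow> nat) set" where
  "coeff_vecs k r h = {l. (\<forall>i<k. l i \<le> r) \<and> (\<Sum>i<k. l i) = h}"

definition wsum :: "nat \<Rightarrow> (nat \<Rightarrow> 'a::semiring_1) \<Rightarrow> (nat \<Rightarrow> nat) \<Rightarrow> 'a" where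
  "wsum k w l = (\<Sum>i<k. of_nat (l i) * w i)"

definition move :: "nat \<Rightarrow> nat \<Rightarrow> (nat \<Rightarrow> nat) \<Rightarrow> nat \<Rightarrow> nat" where
  "move i j l = l(i := l i - 1, j := l j + 1)"

definition reflect :: "nat \<Rightarrow> (nat \<Rightarrow> 'a) \<Rightarrow> nat \<Rightarrow> 'a" where
  "reflect k f i = f (k - Suc i)"

lemma coeff_vecs_iff_wsum:
  "l \<in> coeff_vecs k r h \<longleftrightarrow> (\<forall>i<k. l i \<le> r) \<and> wsum k (\<lambda>_. 1) l = h"
  by (simp add: coeff_vecs_def wsum_def)

lemma wsum_cong: "(\<And>i. i < k \<Longrightarrow> l i = l' i) \<Longrightarrow> wsum k w l = wsum k w l'"
  by (simp add: wsum_def)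

lemma wsum_add: "wsum k w (\<lambda>i. l i + l' i) = wsum k w l + wsum k w l'"
  by (simp add: wsum_def distrib_right sum.distrib)

lemma wsum_diff:
  assumes "l' \<le> l"
  shows "wsum k w (\<lambda>i. l i - l' i) + wsum k w l' = wsum k w l"
  using assms by (simp add: le_fun_def flip: wsum_add)

lemma wsum_mono:
  fixes w :: "nat \<Rightarrow> 'a::linordered_semidom"
  assumes "\<And>i. i < k \<Longrightarrow> 0 \<le> w i" "l \<le> l'"
  shows "wsum k w l \<le> wsum k w l'"
  unfolding wsum_def using assms by (intro sum_mono mult_right_mono) (auto simp: le_fun_def)

lemma wsum_ge_term:
  fixes w :: "nat \<Rightarrow> 'a::linordered_semidom"
  assumes "\<And>i. i < k \<Longrightarrow> 0 \<le> w i" "j < k" "0 < l j"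
  shows "w j \<le> wsum k w l"
proof -
  have "1 * w j \<le> of_nat (l j) * w j" using assms by (intro mult_right_mono) auto
  also have "\<dots> \<le> wsum k w l"
    unfolding wsum_def using assms by (intro member_le_sum) auto
  finally show ?thesis by simp
qed

lemma finite_wsum_coeff_vecs: "finite (wsum k w ` coeff_vecs k r h)"
proof (rule finite_subset)
  show "wsum k w ` coeff_vecs k r h \<subseteq> wsum k w ` ({..<k} \<rightarrow>\<^sub>E {..r})"
  proof
    fix s assume "s \<in> wsum k w ` coeff_vecs k r h"
    then obtain l where "l \<in> coeff_vecs k r h" "s = wsum k w l" by blast
    then have "s = wsum k w (restrict l {..<k})" "restrict l {..<k} \<in> {..<k} \<rightarrow>\<^sub>E {..r}"
      by (auto simp: coeff_vecs_def intro: wsum_cong)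
    then show "s \<in> wsum k w ` ({..<k} \<rightarrow>\<^sub>E {..r})" by blast
  qed
  show "finite (wsum k w ` ({..<k} \<rightarrow>\<^sub>E {..r}))" by (simp add: finite_PiE)
qed

lemma wsum_move:
  assumes "i < k" "j < k" "i \<noteq> j" "0 < l i"
  shows "wsum k w (move i j l) + w i = wsum k w l + w j"
proof -
  obtain m where "l i = Suc m" using assms(4) gr0_implies_Suc by blast
  then have "of_nat (move i j l n) * w n + (if n = i then w n else 0)
      = of_nat (l n) * w n + (if n = j then w n else 0)" for n
    using assms(3) by (simp add: move_def distrib_right ac_simps)
  then have "(\<Sum>n<k. of_nat (move i j l n) * w n + (if n = i then w n else 0))
      = (\<Sum>n<k. of_nat (l n) * w n + (if n = j then w n else 0))" by simp
  then show ?thesis using assms(1,2) by (simp add: wsum_def sum.distrib)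
qed

lemma move_in_coeff_vecs:
  assumes "l \<in> coeff_vecs k r h" "i < k" "j < k" "i \<noteq> j" "0 < l i" "l j < r"
  shows "move i j l \<in> coeff_vecs k r h"
proof -
  have "\<forall>n<k. move i j l n \<le> r" using assms by (auto simp: move_def coeff_vecs_def)
  then show ?thesis
    using assms wsum_move[of i k j l "\<lambda>_. 1 :: nat"] by (simp add: coeff_vecs_iff_wsum)
qed

lemma reflect_reflect: "i < k \<Longrightarrow> reflect k (reflect k f) i = f i"
  by (simp add: reflect_def)

lemma wsum_reflect: "wsum k w (reflect k l) = wsum k (reflect k w) l"
proof -
  have "wsum k w (reflect k l) = (\<Sum>i<k. of_nat (l (k - Suc i)) * reflect k w (k - Suc i))"
    unfolding wsum_def by (intro sum.cong) (auto simp: reflect_def)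
  also have "\<dots> = wsum k (reflect k w) l"
    unfolding wsum_def by (rule sum.nat_diff_reindex[of "\<lambda>i. of_nat (l i) * reflect k w i"])
  finally show ?thesis .
qed

lemma reflect_const: "reflect k (\<lambda>_. c) = (\<lambda>_. c)"
  by (simp add: reflect_def fun_eq_iff)

lemma reflect_in_coeff_vecs: "l \<in> coeff_vecs k r h \<Longrightarrow> reflect k l \<in> coeff_vecs k r h"
  by (simp add: coeff_vecs_iff_wsum wsum_reflect reflect_const) (simp add: reflect_def)

lemma wsum_int_reflect:
  "wsum k int (reflect k l) = (int k - 1) * int (\<Sum>i<k. l i) - wsum k int l"
proof -
  have "wsum k int (reflect k l) = (\<Sum>i<k. (int k - 1) * int (l i) - int (l i) * int i)"
    unfolding wsum_reflect unfolding wsum_def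
    by (intro sum.cong) (auto simp: reflect_def algebra_simps)
  then show ?thesis by (simp add: wsum_def sum_subtractf sum_distrib_left)
qed

section \<open>Packed vectors\<close>

definition left_packed :: "nat \<Rightarrow> nat \<Rightarrow> nat \<Rightarrow> nat" where
  "left_packed r h i = min r (h - i * r)"

definition right_packed :: "nat \<Rightarrow> nat \<Rightarrow> nat \<Rightarrow> nat \<Rightarrow> nat" where
  "right_packed k r h = reflect k (left_packed r h)"

definition left_stable :: "nat \<Rightarrow> nat \<Rightarrow> (nat \<Rightarrow> nat) \<Rightarrow> bool" where
  "left_stable k r l \<longleftrightarrow> (\<forall>j. Suc j < k \<longrightarrow> l j < r \<longrightarrow> l (Suc j) = 0)"

lemma sum_left_packed: "(\<Sum>i<n. left_packed r h i) = min h (n * r)"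
  by (induction n) (auto simp: left_packed_def min_def)

lemma left_packed_in_coeff_vecs: "h \<le> k * r \<Longrightarrow> left_packed r h \<in> coeff_vecs k r h"
  by (simp add: coeff_vecs_def sum_left_packed) (simp add: left_packed_def)

lemma right_packed_in_coeff_vecs: "h \<le> k * r \<Longrightarrow> right_packed k r h \<in> coeff_vecs k r h"
  unfolding right_packed_def by (intro reflect_in_coeff_vecs left_packed_in_coeff_vecs)

lemma left_packed_mono: "d \<le> h \<Longrightarrow> left_packed r d \<le> left_packed r h"
  by (auto simp: left_packed_def le_fun_def)

lemma left_packed_mult_add:
  assumes "e \<le> r"
  shows "left_packed r (m * r + e) i = (if i < m then r else if i = m then e else 0)"
proof (cases i m rule: linorder_cases)
  case less
  then have "Suc i * r \<le> m * r" by (intro mult_right_mono) auto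
  then show ?thesis using less by (simp add: left_packed_def)
next
  case greater
  then have "Suc m * r \<le> i * r" by (intro mult_right_mono) auto
  then show ?thesis using greater assms by (simp add: left_packed_def)
qed (use assms in \<open>simp add: left_packed_def\<close>)

lemma wsum_left_packed:
  assumes "e \<le> r" "m < k"
  shows "wsum k w (left_packed r (m * r + e)) = of_nat r * (\<Sum>i<m. w i) + of_nat e * w m"
proof -
  have "wsum k w (left_packed r (m * r + e))
      = (\<Sum>i<Suc m. of_nat (left_packed r (m * r + e) i) * w i)"
    unfolding wsum_def using assms
    by (intro sum.mono_neutral_right) (auto simp: left_packed_mult_add)
  then show ?thesis using assms(1) by (simp add: left_packed_mult_add sum_distrib_left)
qed

lemma wsum_int_left_packed:
  assumes "e \<le> r" "m < k"
  shows "2 * wsum k int (left_packed r (m * r + e))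
    = int r * int m * (int m - 1) + 2 * int e * int m"
proof -
  have "2 * (\<Sum>i<m. int i) = int m * (int m - 1)"
    by (induction m) (auto simp: algebra_simps)
  moreover have "2 * wsum k int (left_packed r (m * r + e))
      = int r * (2 * (\<Sum>i<m. int i)) + 2 * int e * int m"
    by (simp add: wsum_left_packed[OF assms])
  ultimately show ?thesis by simp
qed

lemma wsum_int_right_packed:
  assumes "e \<le> r" "m < k"
  shows "2 * wsum k int (right_packed k r (m * r + e))
    = 2 * (int k - 1) * (int m * int r + int e)
      - (int r * int m * (int m - 1) + 2 * int e * int m)"
proof -
  have "m * r + e \<le> Suc m * r" using assms(1) by simp
  also have "\<dots> \<le> k * r" using assms(2) by (intro mult_right_mono) auto
  finally have "(\<Sum>i<k. left_packed r (m * r + e) i) = m * r + e" by (simp add: sum_left_packed)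
  then have "wsum k int (right_packed k r (m * r + e))
      = (int k - 1) * (int m * int r + int e) - wsum k int (left_packed r (m * r + e))"
    unfolding right_packed_def wsum_int_reflect by simp
  then show ?thesis unfolding wsum_int_left_packed[OF assms, symmetric] by simp
qed

lemma zero_if_left_stable:
  assumes "left_stable k r l" "l m < r" "m < n" "n < k"
  shows "l n = 0"
  using \<open>m < n\<close> \<open>n < k\<close>
proof (induction n)
  case (Suc n)
  then have "l n < r" using \<open>l m < r\<close> by (cases "m = n") auto
  then show ?case using Suc.prems assms(1) by (simp add: left_stable_def)
qed simp

lemma sum_prefix_if_left_stable:
  assumes l: "l \<in> coeff_vecs k r h" and stable: "left_stable k r l" and "n \<le> k"
  shows "(\<Sum>j<n. l j) = min h (n * r)"
proof -
  have le_r: "l j \<le> r" if "j < n" for j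
    using l \<open>n \<le> k\<close> that by (simp add: coeff_vecs_def)
  have le_h: "(\<Sum>j<n. l j) \<le> h"
    using l \<open>n \<le> k\<close> sum_mono2[of "{..<k}" "{..<n}" l] by (auto simp: coeff_vecs_def)
  have le_mult: "(\<Sum>j<n. l j) \<le> n * r"
    using sum_bounded_above[of "{..<n}" l r] le_r by simp
  consider (full) "\<forall>j<n. l j = r" | (deficit) m where "m < n" "l m < r"
    using le_r le_neq_implies_less by blast
  then show ?thesis
  proof cases
    case full
    then show ?thesis using le_h by simp
  next
    case deficit
    then have "(\<Sum>j<n. l j) = (\<Sum>j<k. l j)"
      using \<open>n \<le> k\<close> zero_if_left_stable[OF stable, of m]
      by (intro sum.mono_neutral_left) auto
    then have "(\<Sum>j<n. l j) = h" using l by (simp add: coeff_vecs_def)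
    then show ?thesis using le_mult by simp
  qed
qed

lemma left_packed_if_left_stable:
  assumes "l \<in> coeff_vecs k r h" "left_stable k r l" "i < k"
  shows "l i = left_packed r h i"
  using sum_prefix_if_left_stable[OF assms(1,2), of i]
    sum_prefix_if_left_stable[OF assms(1,2), of "Suc i"] assms(3)
  by (auto simp: left_packed_def min_def split: if_splits)

lemma coeff_vecs_left_cases [consumes 1, case_names packed deficit]:
  assumes "l \<in> coeff_vecs k r h"
  obtains "\<And>i. i < k \<Longrightarrow> l i = left_packed r h i"
    | j where "Suc j < k" "0 < l (Suc j)" "l j < r"
proof (cases "left_stable k r l")
  case True
  then show ?thesis using left_packed_if_left_stable[OF assms] that(1) by blast
next
  case False
  then show ?thesis using that(2) by (auto simp: left_stable_def)
qed

lemma coeff_vecs_right_cases [consumes 1, case_names packed deficit]: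
  assumes "l \<in> coeff_vecs k r h"
  obtains "\<And>i. i < k \<Longrightarrow> l i = right_packed k r h i"
    | j where "Suc j < k" "0 < l j" "l (Suc j) < r"
  using reflect_in_coeff_vecs[OF assms]
proof (cases rule: coeff_vecs_left_cases)
  case packed
  have "l i = right_packed k r h i" if "i < k" for i
    using packed[of "k - Suc i"] reflect_reflect[OF that, of l] that
    by (simp add: right_packed_def reflect_def)
  then show ?thesis by (rule that(1))
next
  case (deficit j)
  then have "Suc (k - Suc (Suc j)) = k - Suc j" by simp
  with deficit show ?thesis by (intro that(2)[of "k - Suc (Suc j)"]) (auto simp: reflect_def)
qed

lemma left_packed_diff_in_coeff_vecs:
  assumes "d \<le> h" "h \<le> k * r"
  shows "(\<lambda>n. left_packed r h n - left_packed r d n) \<in> coeff_vecs k r (h - d)"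
proof -
  have "wsum k (\<lambda>_. 1) (left_packed r d) = d" "wsum k (\<lambda>_. 1) (left_packed r h) = h"
    using left_packed_in_coeff_vecs[of d k r] left_packed_in_coeff_vecs[of h k r] assms
    by (auto simp: coeff_vecs_iff_wsum)
  then have "wsum k (\<lambda>_. 1) (\<lambda>n. left_packed r h n - left_packed r d n) = h - d"
    using wsum_diff[OF left_packed_mono[OF assms(1), of r], of k "\<lambda>_. 1 :: nat"] by linarith
  moreover have "left_packed r h n - left_packed r d n \<le> r" for n
    by (simp add: left_packed_def)
  ultimately show ?thesis by (simp add: coeff_vecs_iff_wsum)
qed

text \<open>The bound on \<open>h + d\<close> makes the two packed vectors occupy disjoint positions.\<close>

lemma right_packed_add_left_packed_in_coeff_vecs:
  assumes "h + d \<le> (k - 1) * r"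
  shows "(\<lambda>n. right_packed k r h n + left_packed r d n) \<in> coeff_vecs k r (h + d)"
proof -
  have "right_packed k r h n + left_packed r d n \<le> r" if "n < k" for n
  proof -
    have "(k - Suc n) * r + n * r = (k - 1) * r" using that by (simp flip: distrib_right)
    then have "h \<le> (k - Suc n) * r \<or> d \<le> n * r" using assms by linarith
    then show ?thesis by (auto simp: right_packed_def reflect_def left_packed_def)
  qed
  moreover have "h \<le> k * r" "d \<le> k * r" using assms by (auto simp: diff_mult_distrib)
  ultimately show ?thesis
    using right_packed_in_coeff_vecs[of h k r] left_packed_in_coeff_vecs[of d k r]
    by (simp add: coeff_vecs_iff_wsum wsum_add)
qed

lemma exists_between_with_sum:
  fixes b c :: "'a \<Rightarrow> nat"
  assumes "finite S" "\<And>i. i \<in> S \<Longrightarrow> b i \<le> c i" "sum b S \<le> h" "h \<le> sum c S"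
  shows "\<exists>l. (\<forall>i\<in>S. b i \<le> l i \<and> l i \<le> c i) \<and> sum l S = h"
  using assms
proof (induction S arbitrary: h rule: finite_induct)
  case (insert x S)
  define y where "y = max (b x) (h - sum c S)"
  have "b x \<le> c x" "sum b S \<le> sum c S" "b x + sum b S \<le> h" "h \<le> c x + sum c S"
    using insert.hyps insert.prems by (simp_all add: sum_mono)
  then have y_bounds: "b x \<le> y" "y \<le> c x" "sum b S \<le> h - y" "h - y \<le> sum c S" "y \<le> h"
    unfolding y_def by linarith+
  have "b i \<le> c i" if "i \<in> S" for i using insert.prems(1) that by simp
  from insert.IH[OF this y_bounds(3,4)]
  obtain l where between: "\<forall>i\<in>S. b i \<le> l i \<and> l i \<le> c i" and total: "sum l S = h - y" by blast
  have "sum (l(x := y)) S = sum l S" using insert.hyps by (intro sum.cong) auto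
  then have "sum (l(x := y)) (insert x S) = h" using insert.hyps total y_bounds(5) by simp
  moreover have "\<forall>i\<in>insert x S. b i \<le> (l(x := y)) i \<and> (l(x := y)) i \<le> c i"
    using between y_bounds(1,2) by simp
  ultimately show ?case by blast
qed simp

lemma exists_coeff_vec_pos_on_less_on:
  assumes "P \<subseteq> {..<k}" "D \<subseteq> {..<k}" "P \<inter> D = {}" "0 < r" "card P \<le> h" "h + card D \<le> k * r"
  obtains l where "l \<in> coeff_vecs k r h" "\<And>i. i \<in> P \<Longrightarrow> 0 < l i" "\<And>i. i \<in> D \<Longrightarrow> l i < r"
proof -
  have sum_of_bool: "(\<Sum>i<k. of_bool (i \<in> X)) = card X" if "X \<subseteq> {..<k}" for X :: "nat set"
    using that by (simp add: Int_absorb1)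
  have "(\<Sum>i<k. r - of_bool (i \<in> D)) = k * r - card D"
    using assms(2,4) sum_of_bool[OF assms(2)]
      sum_subtractf_nat[of "{..<k}" "\<lambda>i. of_bool (i \<in> D)" "\<lambda>_. r"] by auto
  then have "\<exists>l. (\<forall>i\<in>{..<k}. of_bool (i \<in> P) \<le> l i \<and> l i \<le> r - of_bool (i \<in> D))
      \<and> sum l {..<k} = h"
    using assms sum_of_bool[OF assms(1)] by (intro exists_between_with_sum) auto
  then obtain l where between: "\<forall>i\<in>{..<k}. of_bool (i \<in> P) \<le> l i \<and> l i \<le> r - of_bool (i \<in> D)"
    and total: "sum l {..<k} = h" by blast
  have lower: "of_bool (i \<in> P) \<le> l i" and upper: "l i \<le> r - of_bool (i \<in> D)" if "i < k" for i
    using between that by simp_all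
  show thesis
  proof
    have "l i \<le> r" if "i < k" for i using upper[OF that] by linarith
    then show "l \<in> coeff_vecs k r h" using total by (simp add: coeff_vecs_def)
    show "0 < l i" if "i \<in> P" for i using lower[of i] assms(1) that by auto
    show "l i < r" if "i \<in> D" for i using upper[of i] assms(2,4) that by auto
  qed
qed

section \<open>The bound\<close>

definition L_term :: "int \<Rightarrow> nat \<Rightarrow> nat \<Rightarrow> nat \<Rightarrow> int" where
  "L_term k r h' h =
     int r * (int (h div r) - int (h' div r)) * (k - int (h div r))
     + (int (h mod r) - int (h' mod r)) * (k - int (h div r) - 1)
     - max (int (h mod r)) (int (h' mod r)) * (int (h div r) - int (h' div r))"

lemma L_bound_eq_sum_L_term:
  "L_bound k H r = (\<Sum>i<card H. L_term k r (nth_elem H i) (nth_elem H (Suc i)) + 1)"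
  by (simp add: L_bound_def L_term_def sum.atLeast1_atMost_eq)

text \<open>Write \<open>h = m * r + e\<close> and \<open>h' = m' * r + e'\<close>. Replacing \<open>h - h'\<close> by the larger
  \<open>(m - m') * r + (max e e' - e')\<close> avoids a case distinction. The inequality is strict if
  \<open>e < e'\<close> and \<open>m - m' \<ge> 2\<close>: there the summand of \<open>L_bound\<close> is not the sharp one.\<close>

lemma L_term_le:
  assumes "0 < r" "h' \<le> h" "h < k * r"
  shows "L_term (int k) r h' h \<le> wsum k int (right_packed k r h) - wsum k int (right_packed k r h')
    - wsum k int (left_packed r (h - h'))"
proof -
  define m e m' e' where "m = h div r" and "e = h mod r" and "m' = h' div r" and "e' = h' mod r"
  note fold_defs = m_def[symmetric] e_def[symmetric] m'_def[symmetric] e'_def[symmetric]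
  have h_eq: "h = m * r + e" and h'_eq: "h' = m' * r + e'"
    by (simp_all add: m_def e_def m'_def e'_def)
  have bounds: "e < r" "e' < r" "m < k" "m' \<le> m" "m' < k"
    using assms div_le_mono[of h' h r] less_mult_imp_div_less[of h k r]
    by (auto simp: m_def e_def m'_def e'_def)
  define q f where "q = m - m'" and "f = max e e' - e'"
  have int_q: "int q = int m - int m'" and int_f: "int f = max (int e) (int e') - int e'"
    using bounds by (auto simp: q_def f_def)
  have "f \<le> r" "q < k" using bounds by (auto simp: q_def f_def)
  have "h - h' \<le> q * r + f"
    using bounds(4) by (auto simp: h_eq h'_eq q_def f_def diff_mult_distrib)
  then have "wsum k int (left_packed r (h - h')) \<le> wsum k int (left_packed r (q * r + f))"
    by (intro wsum_mono left_packed_mono) auto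
  then have "2 * wsum k int (left_packed r (h - h'))
      \<le> int r * int q * (int q - 1) + 2 * int f * int q"
    unfolding wsum_int_left_packed[OF \<open>f \<le> r\<close> \<open>q < k\<close>, symmetric] by simp
  moreover have "2 * L_term (int k) r h' h
      = 2 * wsum k int (right_packed k r (m * r + e)) - 2 * wsum k int (right_packed k r (m' * r + e'))
        - (int r * int q * (int q - 1) + 2 * int f * int q)"
    using wsum_int_right_packed[of e r m k] wsum_int_right_packed[of e' r m' k] bounds
    unfolding L_term_def fold_defs int_q int_f by (simp add: algebra_simps)
  ultimately have "2 * L_term (int k) r h' h
      \<le> 2 * (wsum k int (right_packed k r h) - wsum k int (right_packed k r h')
        - wsum k int (left_packed r (h - h')))"
    unfolding right_diff_distrib h_eq[symmetric] h'_eq[symmetric] by (simp only: diff_left_mono)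
  then show ?thesis by simp
qed

section \<open>Chains of sumsets\<close>

locale sumset_chain =
  fixes r k t :: nat and a :: "nat \<Rightarrow> int" and h :: "nat \<Rightarrow> nat"
  assumes a_strict_mono: "strict_mono_on {..<k} a" and a_pos: "\<And>i. i < k \<Longrightarrow> 0 < a i"
    and h_0: "h 0 = 0" and h_strict_mono: "strict_mono_on {..t} h" and h_less: "h t < (k - 1) * r"
begin

definition configs :: "(nat \<times> (nat \<Rightarrow> nat)) set" where
  "configs = (SIGMA i:{1..t}. coeff_vecs k r (h i))"

definition gap :: "nat \<Rightarrow> nat" where
  "gap i = h (Suc i) - h i"

definition offset :: "nat \<Rightarrow> int" where
  "offset i = (\<Sum>j<i. wsum k int (left_packed r (gap j)) - 1)"

fun grade :: "nat \<times> (nat \<Rightarrow> nat) \<Rightarrow> int" where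
  "grade (i, l) = wsum k int l - offset i - 1"

fun val :: "nat \<times> (nat \<Rightarrow> nat) \<Rightarrow> int" where
  "val (i, l) = wsum k a l"

definition num_grades :: int where
  "num_grades = wsum k int (right_packed k r (h t)) - offset t"

definition ascent :: "nat \<Rightarrow> nat \<Rightarrow> nat" where
  "ascent i n = right_packed k r (h i) n + left_packed r (gap i) n"

definition descent :: "nat \<Rightarrow> nat \<Rightarrow> nat" where
  "descent i n = left_packed r (h (Suc i)) n - left_packed r (gap i) n"

lemma r_pos: "0 < r" and k_gt_1: "1 < k"
  using h_less by (auto intro!: gr0I) (rule ccontr, simp)

lemma h_le: "\<lbrakk>i \<le> j; j \<le> t\<rbrakk> \<Longrightarrow> h i \<le> h j"
  using strict_mono_on_leD[OF h_strict_mono] by simp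

lemma h_bounds:
  assumes "i \<le> t"
  shows "h i < (k - 1) * r" "h i \<le> k * r"
  using h_le[OF assms] h_less by (auto simp: diff_mult_distrib)

lemma h_Suc: "i < t \<Longrightarrow> h (Suc i) = h i + gap i"
  using h_le[of i "Suc i"] by (simp add: gap_def)

lemma gap_pos: "i < t \<Longrightarrow> 0 < gap i"
  using strict_mono_onD[OF h_strict_mono, of i "Suc i"] by (simp add: gap_def)

lemma a_less_Suc: "Suc i < k \<Longrightarrow> a i < a (Suc i)"
  using strict_mono_onD[OF a_strict_mono, of i "Suc i"] by simp

lemma wsum_left_packed_gap_pos:
  assumes "i < t"
  shows "0 < wsum k a (left_packed r (gap i))"
proof -
  have "a 0 \<le> wsum k a (left_packed r (gap i))"
    using a_pos k_gt_1 gap_pos[OF assms] r_pos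
    by (intro wsum_ge_term) (auto simp: left_packed_def less_imp_le)
  then show ?thesis using a_pos[of 0] k_gt_1 by simp
qed

lemma right_packed_in_configs: "i \<in> {1..t} \<Longrightarrow> (i, right_packed k r (h i)) \<in> configs"
  using h_bounds by (simp add: configs_def right_packed_in_coeff_vecs)

lemma
  assumes "(i, l) \<in> configs" "n < k" "n' < k" "n \<noteq> n'" "0 < l n" "l n' < r"
  shows move_in_configs: "(i, move n n' l) \<in> configs"
    and grade_move: "grade (i, move n n' l) = grade (i, l) + int n' - int n"
    and val_move: "val (i, move n n' l) = val (i, l) + a n' - a n"
  using assms wsum_move[of n k n' l int] wsum_move[of n k n' l a]
  by (auto simp: configs_def intro: move_in_coeff_vecs)

lemma
  assumes "i < t"
  shows ascent_in_configs: "(Suc i, ascent i) \<in> configs"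
    and grade_ascent: "grade (Suc i, ascent i) = grade (i, right_packed k r (h i)) + 1"
    and val_ascent: "val (Suc i, ascent i)
      = val (i, right_packed k r (h i)) + wsum k a (left_packed r (gap i))"
proof -
  have "ascent i \<in> coeff_vecs k r (h (Suc i))"
    using right_packed_add_left_packed_in_coeff_vecs[of "h i" "gap i" k r] h_bounds(1)[of "Suc i"]
      h_Suc[OF assms] assms by (simp add: ascent_def[abs_def])
  then show "(Suc i, ascent i) \<in> configs" using assms by (simp add: configs_def)
qed (simp_all add: ascent_def[abs_def] wsum_add offset_def)

lemma
  assumes "1 \<le> i" "i < t"
  shows descent_in_configs: "(i, descent i) \<in> configs"
    and grade_descent: "grade (i, descent i) = grade (Suc i, left_packed r (h (Suc i))) - 1"
    and val_descent: "val (i, descent i)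
      = val (Suc i, left_packed r (h (Suc i))) - wsum k a (left_packed r (gap i))"
proof -
  have "descent i \<in> coeff_vecs k r (h i)"
    using left_packed_diff_in_coeff_vecs[of "gap i" "h (Suc i)" k r] h_bounds(2)[of "Suc i"]
      h_Suc[OF assms(2)] assms by (simp add: descent_def[abs_def])
  then show "(i, descent i) \<in> configs" using assms by (simp add: configs_def)
  have "gap i \<le> h (Suc i)" by (simp add: gap_def)
  then have diff: "wsum k w (descent i)
      = wsum k w (left_packed r (h (Suc i))) - wsum k w (left_packed r (gap i))" for w :: "nat \<Rightarrow> int"
    using wsum_diff[OF left_packed_mono[of "gap i" "h (Suc i)" r], of k w]
    by (simp add: descent_def[abs_def])
  show "grade (i, descent i) = grade (Suc i, left_packed r (h (Suc i))) - 1"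
    "val (i, descent i) = val (Suc i, left_packed r (h (Suc i))) - wsum k a (left_packed r (gap i))"
    by (simp_all add: diff offset_def)
qed

lemma exists_predecessor:
  assumes "x \<in> configs" "0 < grade x"
  shows "\<exists>y\<in>configs. grade y = grade x - 1 \<and> val y < val x"
proof -
  obtain i l where x_eq: "x = (i, l)" by (cases x)
  then have "1 \<le> i" "i \<le> t" "l \<in> coeff_vecs k r (h i)" using assms(1) by (auto simp: configs_def)
  from this(3) show ?thesis
  proof (cases rule: coeff_vecs_left_cases)
    case packed
    then have wsum_l: "wsum k w l = wsum k w (left_packed r (h i))" for w :: "nat \<Rightarrow> int"
      by (rule wsum_cong)
    obtain i' where i_eq: "i = Suc i'" using \<open>1 \<le> i\<close> by (cases i) auto
    have "i' \<noteq> 0"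
      using assms(2) wsum_l[of int] h_0 by (intro notI) (simp add: x_eq i_eq offset_def gap_def)
    then have "1 \<le> i'" "i' < t" using i_eq \<open>i \<le> t\<close> by auto
    then show ?thesis
      using descent_in_configs grade_descent val_descent wsum_left_packed_gap_pos wsum_l
      by (intro bexI[of _ "(i', descent i')"]) (auto simp: x_eq i_eq)
  next
    case (deficit j)
    then show ?thesis
      using assms(1) move_in_configs[of i l "Suc j" j] grade_move[of i l "Suc j" j]
        val_move[of i l "Suc j" j] a_less_Suc[of j] unfolding x_eq
      by (intro bexI[of _ "(i, move (Suc j) j l)"]) auto
  qed
qed

lemma exists_successor:
  assumes "x \<in> configs" "grade x < num_grades - 1"
  shows "\<exists>y\<in>configs. grade y = grade x + 1 \<and> val x < val y"
proof -
  obtain i l where x_eq: "x = (i, l)" by (cases x)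
  then have "i \<le> t" "l \<in> coeff_vecs k r (h i)" using assms(1) by (auto simp: configs_def)
  from this(2) show ?thesis
  proof (cases rule: coeff_vecs_right_cases)
    case packed
    then have wsum_l: "wsum k w l = wsum k w (right_packed k r (h i))" for w :: "nat \<Rightarrow> int"
      by (rule wsum_cong)
    have "i \<noteq> t"
      using assms(2) wsum_l[of int] by (auto simp: x_eq num_grades_def)
    then have "i < t" using \<open>i \<le> t\<close> by simp
    then show ?thesis
      using ascent_in_configs grade_ascent val_ascent wsum_left_packed_gap_pos wsum_l
      by (intro bexI[of _ "(Suc i, ascent i)"]) (auto simp: x_eq)
  next
    case (deficit j)
    then show ?thesis
      using assms(1) move_in_configs[of i l j "Suc j"] grade_move[of i l j "Suc j"]
        val_move[of i l j "Suc j"] a_less_Suc[of j] unfolding x_eq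
      by (intro bexI[of _ "(i, move j (Suc j) l)"]) auto
  qed
qed

lemma val_image_eq: "val ` configs = (\<Union>i\<in>{1..t}. wsum k a ` coeff_vecs k r (h i))"
  by (force simp: configs_def)

lemma sum_L_term_le_num_grades: "(\<Sum>i<t. L_term (int k) r (h i) (h (Suc i)) + 1) \<le> num_grades"
proof -
  define top_sum where "top_sum i = wsum k int (right_packed k r (h i))" for i
  have "top_sum 0 = 0"
    by (simp add: top_sum_def h_0 right_packed_def reflect_def left_packed_def wsum_def)
  have "L_term (int k) r (h i) (h (Suc i)) + 1
      \<le> (top_sum (Suc i) - top_sum i) - (wsum k int (left_packed r (gap i)) - 1)" if "i < t" for i
  proof -
    have "h (Suc i) < k * r" using h_bounds(1)[of "Suc i"] that by (auto simp: diff_mult_distrib)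
    then show ?thesis
      using L_term_le[OF r_pos h_le, of i "Suc i" k] that by (simp add: top_sum_def gap_def)
  qed
  then have "(\<Sum>i<t. L_term (int k) r (h i) (h (Suc i)) + 1)
      \<le> (\<Sum>i<t. (top_sum (Suc i) - top_sum i) - (wsum k int (left_packed r (gap i)) - 1))"
    by (intro sum_mono) simp
  also have "\<dots> = top_sum t - top_sum 0 - offset t"
    unfolding offset_def sum_subtractf[of "\<lambda>i. top_sum (Suc i) - top_sum i"] sum_lessThan_telescope ..
  finally show ?thesis using \<open>top_sum 0 = 0\<close> by (simp add: num_grades_def top_sum_def)
qed

end

lemma gen_sumset_image:
  assumes inj: "inj_on a {..<k}"
  shows "gen_sumset r h (a ` {..<k}) = wsum k a ` coeff_vecs k r h"
proof (intro equalityI subsetI)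
  fix s assume "s \<in> gen_sumset r h (a ` {..<k})"
  then obtain f where f_rep: "s = (\<Sum>x\<in>a ` {..<k}. int (f x) * x)"
      "\<forall>x\<in>a ` {..<k}. f x \<le> r" "(\<Sum>x\<in>a ` {..<k}. f x) = h"
    unfolding gen_sumset_def by blast
  have "f \<circ> a \<in> coeff_vecs k r h" using f_rep(2,3) inj by (simp add: coeff_vecs_def sum.reindex)
  moreover have "s = wsum k a (f \<circ> a)" using f_rep(1) inj by (simp add: wsum_def sum.reindex)
  ultimately show "s \<in> wsum k a ` coeff_vecs k r h" by blast
next
  fix s assume "s \<in> wsum k a ` coeff_vecs k r h"
  then obtain l where l_rep: "l \<in> coeff_vecs k r h" "s = wsum k a l" by blast
  define f where "f = l \<circ> inv_into {..<k} a"
  have f_a: "f (a i) = l i" if "i < k" for i using that inj by (simp add: f_def)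
  have "s = (\<Sum>x\<in>a ` {..<k}. int (f x) * x)"
    using l_rep(2) inj f_a by (simp add: wsum_def sum.reindex)
  moreover have "(\<forall>x\<in>a ` {..<k}. f x \<le> r) \<and> (\<Sum>x\<in>a ` {..<k}. f x) = h"
    using l_rep(1) f_a inj by (simp add: coeff_vecs_def sum.reindex)
  ultimately show "s \<in> gen_sumset r h (a ` {..<k})" unfolding gen_sumset_def by blast
qed

lemma is_arith_prog_image_lessThan:
  assumes "0 < n" "\<And>i. Suc i < n \<Longrightarrow> f (Suc i) = f i + d"
  shows "is_arith_prog d (f ` {..<n})"
proof -
  have linear: "f i = f 0 + of_nat i * d" if "i < n" for i
    using that assms(2) by (induction i) (auto simp: algebra_simps)
  have "f ` {..<n} = (\<lambda>i. f 0 + of_nat i * d) ` {..<n}"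
    by (rule image_cong[OF refl], rule linear) simp
  also have "\<dots> = {f 0 + of_nat i * d | i. i < n}" by auto
  finally show ?thesis
    using assms(1) unfolding is_arith_prog_def by (intro exI[of _ "f 0"] exI[of _ n]) simp
qed

section \<open>Extremal chains\<close>

locale extremal_sumset_chain = sumset_chain +
  assumes k_ge: "5 \<le> k" and t_ge: "2 \<le> t"
    and extremal: "int (card (gen_sumset_family r (h ` {1..t}) (a ` {..<k})))
      \<le> (\<Sum>i<t. L_term (int k) r (h i) (h (Suc i)) + 1)"
begin

lemma val_eq_if_grade_eq:
  assumes "x \<in> configs" "y \<in> configs" "grade x = grade y"
  shows "val x = val y"
proof (rule value_eq_if_grade_eq[OF _ _ exists_predecessor exists_successor])
  show "finite (val ` configs)" by (simp add: val_image_eq finite_wsum_coeff_vecs)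
  have "val ` configs = gen_sumset_family r (h ` {1..t}) (a ` {..<k})"
    using gen_sumset_image[OF strict_mono_on_imp_inj_on[OF a_strict_mono]]
    by (simp add: val_image_eq gen_sumset_family_def)
  then show "int (card (val ` configs)) \<le> num_grades"
    using extremal sum_L_term_le_num_grades by simp
qed (use assms in auto)

lemma step_eq_if_distant:
  assumes "i + 2 \<le> j" "Suc j < k"
  shows "a (Suc i) - a i = a (Suc j) - a j"
proof -
  have "h 0 < h 1" "h 1 < h t"
    using t_ge by (auto intro!: strict_mono_onD[OF h_strict_mono])
  then have "2 \<le> h t" by linarith
  have "h t + 2 \<le> k * r" using h_less r_pos by (auto simp: diff_mult_distrib)
  obtain l where movable: "l \<in> coeff_vecs k r (h t)"
      "\<And>n. n \<in> {i, j} \<Longrightarrow> 0 < l n" "\<And>n. n \<in> {Suc i, Suc j} \<Longrightarrow> l n < r"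
    by (rule exists_coeff_vec_pos_on_less_on[of "{i, j}" k "{Suc i, Suc j}" r "h t"])
      (use assms r_pos \<open>2 \<le> h t\<close> \<open>h t + 2 \<le> k * r\<close> in auto)
  from movable(1) have "(t, l) \<in> configs" using t_ge by (simp add: configs_def)
  note moves = move_in_configs[OF this] grade_move[OF this] val_move[OF this]
  have "val (t, move i (Suc i) l) = val (t, move j (Suc j) l)"
    using assms movable moves by (intro val_eq_if_grade_eq) auto
  then show ?thesis using assms movable moves by simp
qed

lemma step_eq:
  assumes "Suc i < k"
  shows "a (Suc i) - a i = a 1 - a 0"
proof -
  consider (first) "i = 0" | (second) "i = 1" | (later) "2 \<le> i" by linarith
  then show ?thesis
  proof cases
    case second
    then show ?thesis using step_eq_if_distant[of 1 3] step_eq_if_distant[of 0 3] k_ge by simp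
  qed (use step_eq_if_distant[of 0 i] assms in auto)
qed

lemma wsum_left_packed_gap:
  assumes "1 \<le> i" "i < t"
  shows "wsum k a (left_packed r (gap i)) = a 1 - a 0"
proof -
  have "ascent i \<in> coeff_vecs k r (h (Suc i))"
    using ascent_in_configs[OF assms(2)] by (simp add: configs_def)
  then obtain j where movable: "Suc j < k" "0 < ascent i (Suc j)" "ascent i j < r"
  proof (cases rule: coeff_vecs_left_cases)
    case packed
    have "0 < ascent i (k - 1)"
      using strict_mono_onD[OF h_strict_mono, of 0 i] assms r_pos
      by (simp add: ascent_def right_packed_def reflect_def left_packed_def)
    moreover have "left_packed r (h (Suc i)) (k - 1) = 0"
      using h_bounds(1)[of "Suc i"] assms by (simp add: left_packed_def)
    ultimately show thesis using packed[of "k - 1"] k_ge by simp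
  qed
  note moves = move_in_configs[OF ascent_in_configs, of i "Suc j" j]
    grade_move[OF ascent_in_configs, of i "Suc j" j] val_move[OF ascent_in_configs, of i "Suc j" j]
  have "val (i, right_packed k r (h i)) = val (Suc i, move (Suc j) j (ascent i))"
    using moves movable assms grade_ascent[OF assms(2)]
    by (intro val_eq_if_grade_eq right_packed_in_configs) auto
  then show ?thesis
    using moves movable assms val_ascent[OF assms(2)] step_eq[OF movable(1)] by simp
qed

lemma gap_le:
  assumes "1 \<le> i" "i < t"
  shows "gap i \<le> r"
proof (rule ccontr)
  assume "\<not> gap i \<le> r"
  then have "a 1 \<le> wsum k a (left_packed r (gap i))"
    using a_pos k_ge r_pos by (intro wsum_ge_term) (auto simp: left_packed_def less_imp_le)
  then show False using wsum_left_packed_gap[OF assms] a_pos[of 0] k_ge by simp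
qed

lemma gap_mult:
  assumes "1 \<le> i" "i < t"
  shows "int (gap i) * a 0 = a 1 - a 0"
  using wsum_left_packed_gap[OF assms] wsum_left_packed[OF gap_le[OF assms], of 0 k a] k_ge by simp

lemma Min_image_a: "Min (a ` {..<k}) = a 0"
  using strict_mono_on_leD[OF a_strict_mono, of 0] k_ge by (intro Min_eqI) auto

lemma is_arith_prog_image_a: "is_arith_prog (a 1 - a 0) (a ` {..<k})"
proof (rule is_arith_prog_image_lessThan)
  show "a (Suc i) = a i + (a 1 - a 0)" if "Suc i < k" for i using step_eq[OF that] by simp
qed (use k_ge in simp)

lemma is_arith_prog_image_h: "is_arith_prog (gap 1) (h ` {1..t})"
proof -
  have "h (Suc (Suc i)) = h (Suc i) + gap 1" if "Suc i < t" for i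
  proof -
    have "int (gap (Suc i)) * a 0 = int (gap 1) * a 0"
      using gap_mult[of "Suc i"] gap_mult[of 1] that by simp
    then have "gap (Suc i) = gap 1" using a_pos[of 0] k_ge by simp
    then show ?thesis using h_Suc[OF that] by simp
  qed
  then have "is_arith_prog (gap 1) ((\<lambda>i. h (Suc i)) ` {..<t})"
    using t_ge by (intro is_arith_prog_image_lessThan) auto
  then show ?thesis unfolding image_Suc_lessThan[symmetric] image_image .
qed

lemma arith_progs:
  "\<exists>d. 1 \<le> d \<and> d \<le> r \<and> is_arith_prog d (h ` {1..t})
    \<and> is_arith_prog (int d * Min (a ` {..<k})) (a ` {..<k})"
proof (intro exI conjI)
  show "1 \<le> gap 1" "gap 1 \<le> r" using gap_pos[of 1] gap_le[of 1] t_ge by auto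
  show "is_arith_prog (int (gap 1) * Min (a ` {..<k})) (a ` {..<k})"
    using is_arith_prog_image_a gap_mult[of 1] t_ge by (simp add: Min_image_a)
qed (rule is_arith_prog_image_h)

end

section \<open>Enumerating the two sets\<close>

lemma image_nth_sorted_list_of_set:
  "finite A \<Longrightarrow> (!) (sorted_list_of_set A) ` {..<card A} = A"
  using bij_betw_nth[of "sorted_list_of_set A"] by (simp add: bij_betw_def)

lemma strict_mono_on_nth_if_strict_sorted:
  "sorted_wrt (<) xs \<Longrightarrow> strict_mono_on {..<length xs} ((!) xs)"
  by (auto intro!: strict_mono_onI sorted_wrt_nth_less)

lemma image_nth_elem: "finite H \<Longrightarrow> nth_elem H ` {1..card H} = H"
  unfolding image_Suc_lessThan[symmetric] image_image
  using image_nth_sorted_list_of_set[of H] by (simp add: nth_elem_def)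

lemma strict_mono_on_nth_elem:
  assumes "finite H" "\<And>h. h \<in> H \<Longrightarrow> 0 < h"
  shows "strict_mono_on {..card H} (nth_elem H)"
proof -
  have "sorted_wrt (<) (0 # sorted_list_of_set H)" using assms by simp
  from strict_mono_on_nth_if_strict_sorted[OF this] show ?thesis
    by (simp add: nth_elem_def[abs_def] lessThan_Suc_atMost)
qed

theorem theorem3p1:
  fixes r k t :: nat and A :: "int set" and H :: "nat set"
  assumes "r \<ge> 1"
    and "finite A" and "card A = k" and "k \<ge> 6" and "\<forall>a\<in>A. a > 0"
    and "finite H" and "card H = t" and "t \<ge> 2" and "\<forall>h\<in>H. h > 0"
    and "r \<le> Max H" and "int (Max H) \<le> (int k - 1) * int r - 1"
    and "int (card (gen_sumset_family r H A)) = L_bound (int k) H r"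
  shows "\<exists>d::nat. 1 \<le> d \<and> d \<le> r \<and> is_arith_prog d H \<and> is_arith_prog (int d * Min A) A"
proof -
  define a where "a = (!) (sorted_list_of_set A)"
  define h where "h = nth_elem H"
  have A: "a ` {..<k} = A"
    using image_nth_sorted_list_of_set[OF assms(2)] assms(3) by (simp add: a_def)
  have H: "h ` {1..t} = H" using image_nth_elem[OF assms(6)] assms(7) unfolding h_def by blast
  have "h t \<in> H" unfolding H[symmetric] using assms(8) by simp
  then have "int (h t) < (int k - 1) * int r" using Max_ge[OF assms(6)] assms(11) by fastforce
  also have "\<dots> = int ((k - 1) * r)" using assms(4) by simp
  finally have "h t < (k - 1) * r" by (simp only: of_nat_less_iff)
  then interpret extremal_sumset_chain r k t a h
  proof (unfold_locales, unfold A H)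
    show "strict_mono_on {..<k} a"
      using strict_mono_on_nth_if_strict_sorted[of "sorted_list_of_set A"] assms(3) by (simp add: a_def)
    show "strict_mono_on {..t} h" using strict_mono_on_nth_elem assms(6,7,9) by (auto simp: h_def)
    show "0 < a i" if "i < k" for i using A assms(5) that by blast
    show "int (card (gen_sumset_family r H A))
        \<le> (\<Sum>i<t. L_term (int k) r (h i) (h (Suc i)) + 1)"
      using assms(7,12) by (simp add: L_bound_eq_sum_L_term h_def)
  qed (use assms in \<open>simp_all add: h_def nth_elem_def\<close>)
  show ?thesis using arith_progs unfolding A H .
qed

end
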